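(* For any two partitions $\mu^1$ and $\mu^2$, one has $$\prod_k(1-q^kQ)^{-2C_k(\mu^1,(\mu^2)^t)}=Q^{-|\mu^1|-|\mu^2|}\,2^{-2(|\mu^1|+|\mu^2|)}\,q^{-\frac12(\kappa_{\mu^1}-\kappa_{\mu^2})}\prod_{l\ne n}\prod_{i,j\ge1}\frac{\sinh\frac{\beta}{2}(a_{ln}+\hbar(\mu^l_i-\mu^n_j+j-i))}{\sinh\frac{\beta}{2}(a_{ln}+\hbar(j-i))},$$ where $(l,n)$ ranges over $(1,2)$ and $(2,1)$, $a_{12}=-a_{21}=2a$, $Q=e^{-2a\beta}$ and $q=e^{-\beta\hbar}$.
   Context: A partition $\mu$ is a nonincreasing sequence $\mu_1\ge\mu_2\ge\cdots$ of nonnegative integers with finitely many nonzero terms; $l(\mu)$ is the number of nonzero terms, $|\mu|=\sum_i\mu_i$, $\mu^t$ is the transposed partition, $\kappa_\mu=\sum_{i=1}^{l(\mu)}\mu_i(\mu_i-2i+1)$. Define $f_{\lambda\mu}(q)=q\left(\sum_{i\ge1}q^{\lambda_i-i}\sum_{j\ge1}q^{\mu_j-j}-\sum_{i\ge1}q^{-i}\sum_{j\ge1}q^{-j}\right)$ (series summed for $|q|>1$), a Laurent polynomial in $q$ with integer coefficients $C_k(\lambda,\mu)$: $f_{\lambda\mu}(q)=\sum_{k\in\mathbb{Z}}C_k(\lambda,\mu)q^k$. Here $a,\beta,\hbar$ are generic parameters; hyperbolic sines are expressed through exponentials, so $\sinh\frac\beta2(2a+\hbar m)=\frac12(Q^{-1/2}q^{-m/2}-Q^{1/2}q^{m/2})$,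 and the identity is between functions of $Q,q$. Meaning of the formal infinite products (taken after cancellation of equal factors). For partitions $\lambda,\mu$ and $m\in\mathbb{Z}$ let $e_m(\lambda,\mu)$ be the coefficient of $t^m$ in $\sum_{i,j\ge1}(t^{\lambda_i-\mu_j+j-i}-t^{j-i})$, computed coefficientwise (for each $m$ only finitely many pairs $(i,j)$ contribute); $e_m(\lambda,\mu)=0$ for almost all $m$. For $(l,n)=(1,2)$, $$\prod_{i,j\ge1}\frac{\sinh\frac{\beta}{2}(a_{12}+\hbar(\mu^1_i-\mu^2_j+j-i))}{\sinh\frac{\beta}{2}(a_{12}+\hbar(j-i))}:=\prod_{m}\left(\sinh\tfrac{\beta}{2}(a_{12}+\hbar m)\right)^{e_m(\mu^1,\mu^2)}.$$ Since $\sinh$ is odd, the $(i,j)$ ratio for $(l,n)=(2,1)$ equals the $(j,i)$ ratio for $(l,n)=(1,2)$; accordingly the product for $(2,1)$ is by convention the same as that for $(1,2)$. *)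

theory Defs
  imports "HOL-Analysis.Analysis"
begin

text \<open>
  A partition is a function on \<open>nat\<close> whose parts are its values at \<open>1, 2, 3, \<dots>\<close>;
  the value at \<open>0\<close> carries no meaning and is never used.
\<close>

definition is_partition :: "(nat \<Rightarrow> nat) \<Rightarrow> bool" where
  "is_partition \<mu> \<longleftrightarrow> (\<forall>i\<ge>1. \<mu> (i + 1) \<le> \<mu> i) \<and> finite {i. i \<ge> 1 \<and> \<mu> i \<noteq> 0}"

definition part_length :: "(nat \<Rightarrow> nat) \<Rightarrow> nat" where
  "part_length \<mu> = card {i. i \<ge> 1 \<and> \<mu> i \<noteq> 0}"

definition part_size :: "(nat \<Rightarrow> nat) \<Rightarrow> nat" where
  "part_size \<mu> = (\<Sum>i | i \<ge> 1 \<and> \<mu> i \<noteq> 0. \<mu> i)"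

definition transposed :: "(nat \<Rightarrow> nat) \<Rightarrow> nat \<Rightarrow> nat" where
  "transposed \<mu> j = card {i. i \<ge> 1 \<and> \<mu> i \<ge> j}"

definition kappa :: "(nat \<Rightarrow> nat) \<Rightarrow> int" where
  "kappa \<mu> = (\<Sum>i = 1..part_length \<mu>. int (\<mu> i) * (int (\<mu> i) - 2 * int i + 1))"

lemma even_kappa: "even (kappa \<mu>)"
  unfolding kappa_def by (intro dvd_sum) auto

definition f_series :: "(nat \<Rightarrow> nat) \<Rightarrow> (nat \<Rightarrow> nat) \<Rightarrow> complex \<Rightarrow> complex" where
  "f_series \<nu> \<mu> q =
     q * ((\<Sum>\<^sub>\<infinity>i\<in>{1..}. q powi (int (\<nu> i) - int i)) * (\<Sum>\<^sub>\<infinity>j\<in>{1..}. q powi (int (\<mu> j) - int j))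
        - (\<Sum>\<^sub>\<infinity>i\<in>{1..}. q powi (- int i)) * (\<Sum>\<^sub>\<infinity>j\<in>{1..}. q powi (- int j)))"

text \<open>
  The integer coefficients of the Laurent polynomial that \<^const>\<open>f_series\<close> represents
  where its series converge.
\<close>

definition C_coeff :: "(nat \<Rightarrow> nat) \<Rightarrow> (nat \<Rightarrow> nat) \<Rightarrow> int \<Rightarrow> int" where
  "C_coeff \<nu> \<mu> =
     (THE c. finite {k. c k \<noteq> 0} \<and>
        (\<forall>q. norm q > 1 \<longrightarrow> f_series \<nu> \<mu> q = (\<Sum>k | c k \<noteq> 0. of_int (c k) * q powi k)))"

text \<open>
  \<open>e_term \<nu> \<mu> m i j\<close> is the coefficient of \<open>t\<^sup>m\<close> in the single summand
  \<open>t\<^bsup>\<nu>\<^sub>i - \<mu>\<^sub>j + j - i\<^esup> - t\<^bsup>j - i\<^esup>\<close>.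
\<close>

definition e_term :: "(nat \<Rightarrow> nat) \<Rightarrow> (nat \<Rightarrow> nat) \<Rightarrow> int \<Rightarrow> nat \<Rightarrow> nat \<Rightarrow> int" where
  "e_term \<nu> \<mu> m i j =
     of_bool (int (\<nu> i) - int (\<mu> j) + int j - int i = m) - of_bool (int j - int i = m)"

lemma finite_e_term:
  assumes "is_partition \<nu>" "is_partition \<mu>"
  shows "finite {(i, j). i \<ge> 1 \<and> j \<ge> 1 \<and> e_term \<nu> \<mu> m i j \<noteq> 0}"
proof -
  define I where "I = {i. i \<ge> 1 \<and> \<nu> i \<noteq> 0}"
  define J where "J = {j. j \<ge> 1 \<and> \<mu> j \<noteq> 0}"
  have fin: "finite I" "finite J"
    using assms by (auto simp: is_partition_def I_def J_def)
  define N where "N = Max (insert 0 (I \<union> J)) + Max (insert 0 (\<nu> ` I \<union> \<mu> ` J)) + nat \<bar>m\<bar>"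
  have "i \<le> N \<and> j \<le> N" if "i \<ge> 1" "j \<ge> 1" "e_term \<nu> \<mu> m i j \<noteq> 0" for i j
  proof -
    have bnd: "\<nu> i \<le> Max (insert 0 (\<nu> ` I \<union> \<mu> ` J))" "\<mu> j \<le> Max (insert 0 (\<nu> ` I \<union> \<mu> ` J))"
      using that fin by (cases "\<nu> i = 0"; cases "\<mu> j = 0"; auto simp: I_def J_def intro!: Max_ge)+
    have "i \<in> I \<or> j \<in> J"
      using that by (cases "\<nu> i = 0"; cases "\<mu> j = 0") (auto simp: e_term_def I_def J_def)
    hence "i \<le> Max (insert 0 (I \<union> J)) \<or> j \<le> Max (insert 0 (I \<union> J))"
      using fin by (auto intro!: Max_ge)
    moreover have "int (\<nu> i) - int (\<mu> j) + int j - int i = m \<or> int j - int i = m"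
      using that by (auto simp: e_term_def split: if_splits)
    ultimately show ?thesis
      using bnd unfolding N_def by linarith
  qed
  hence "{(i, j). i \<ge> 1 \<and> j \<ge> 1 \<and> e_term \<nu> \<mu> m i j \<noteq> 0} \<subseteq> {..N} \<times> {..N}"
    by auto
  thus ?thesis
    by (rule finite_subset) auto
qed

definition e_coeff :: "(nat \<Rightarrow> nat) \<Rightarrow> (nat \<Rightarrow> nat) \<Rightarrow> int \<Rightarrow> int" where
  "e_coeff \<nu> \<mu> m = (\<Sum>(i, j) | i \<ge> 1 \<and> j \<ge> 1 \<and> e_term \<nu> \<mu> m i j \<noteq> 0. e_term \<nu> \<mu> m i j)"

text \<open>
  The formal value of
  \<open>\<Prod>i,j\<ge>1. sinh (\<beta>/2 * (A l n + h * (mu l i - mu n j + j - i))) / sinh (\<beta>/2 * (A l n + h * (j - i)))\<close>,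
  collected by equal factors.  Since \<open>sinh\<close> is odd, for \<open>A n l = - A l n\<close> the \<open>(i, j)\<close> ratio
  for \<open>(n, l)\<close> is the \<open>(j, i)\<close> ratio for \<open>(l, n)\<close>.  Collecting the factors separately for
  \<open>(n, l)\<close> could nevertheless change the sign, because it separates numerators from
  denominators; by convention the product for \<open>l > n\<close> is the one for \<open>(n, l)\<close>.
\<close>

definition sinh_product ::
  "complex \<Rightarrow> complex \<Rightarrow> (nat \<Rightarrow> nat \<Rightarrow> complex) \<Rightarrow> (nat \<Rightarrow> nat \<Rightarrow> nat) \<Rightarrow> nat \<Rightarrow> nat \<Rightarrow> complex" where
  "sinh_product \<beta> h A mu l n =
     (let l' = min l n; n' = max l n in
        \<Prod>m | e_coeff (mu l') (mu n') m \<noteq> 0.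
          sinh (\<beta> / 2 * (A l' n' + h * of_int m)) powi e_coeff (mu l') (mu n') m)"

end

theory Submission
  imports Defs
begin

text \<open>
  Both sides are products of powers of the factors \<open>1 - q\<^sup>m Q\<close>, because
  \<open>sinh\<^sup>2 x = (1 - y)\<^sup>2 / (4 y)\<close> with \<open>y = exp (- 2 x)\<close>, and \<open>y = q\<^sup>m Q\<close> at the arguments that
  occur (\<open>sinh_square\<close>). The two products over \<open>(l, n)\<close> coincide, so only the square of \<open>sinh\<close>
  matters and no square root of \<open>Q\<close> or \<open>q\<close> is ever chosen. Two things remain: the exponents of
  \<open>1 - q\<^sup>m Q\<close> must agree, and the leftover \<open>\<Prod>m. (4 Q q\<^sup>m) powi (- e\<^sub>m)\<close> must cancel the explicit
  prefactor. The latter needs \<open>\<Sum>m. e\<^sub>m\<close> and \<open>\<Sum>m. m e\<^sub>m\<close>.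
  
  Both follow from one description of the exponents \<open>e\<^sub>m\<close>. With
  \<open>l(t) = \<Sum>i. t\<^bsup>\<nu>\<^sub>i - i\<^esup> - t\<^bsup>- i\<^esup>\<close> and \<open>r(t) = \<Sum>j. t\<^bsup>j - \<mu>\<^sub>j\<^esup> - t\<^sup>j\<close>, expanding the product that
  defines the \<open>e\<^sub>m\<close> gives \<open>\<Sum>m. e\<^sub>m t\<^sup>m = l(t) t / (1 - t) - r(t) / (1 - t) + l(t) r(t)\<close>.
  Summing geometric progressions row by row turns the first two terms into sums over the boxes of the Young
  diagrams: \<open>- \<Sum> t\<^bsup>content\<^esup>\<close> for \<open>\<nu>\<close> and \<open>- \<Sum> t\<^bsup>- content\<^esup>\<close> for \<open>\<mu>\<close>, where the
  content of the box in row \<open>i\<close> and column \<open>c\<close> is \<open>c - i\<close>. The third term is a finite double sum.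
  Lemma \<open>e_coeff_pairing\<close> states this with \<open>t\<^sup>m\<close> replaced by an arbitrary function of \<open>m\<close>.
  
  Taking that function to be \<open>1\<close> or \<open>m\<close>, the double sum vanishes, since \<open>l r\<close> has a double zero at
  \<open>t = 1\<close>. The boxes give minus the total size, and minus the difference of the content sums, which is
  half the difference of the \<open>\<kappa>\<close>'s.
  Taking it to be \<open>q\<^sup>m\<close> gives \<open>- f(q)\<close> for \<open>f\<close> built from \<open>\<nu>\<close> and the transpose of \<open>\<mu>\<close>
  (\<open>f_series_transposed\<close>): transposition replaces contents by their negatives. Since a Laurent polynomial is determined by its
  values, \<open>C\<^sub>m = - e\<^sub>m\<close> (\<open>C_coeff_eq\<close>).
\<close>

section \<open>Sums over the boxes of Young diagrams\<close>

text \<open>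
  The linear form sending \<open>g\<close> to the sum of its values at the contents of the boxes of the
  diagram. Keeping \<open>g\<close> general allows one computation to serve for indicator functions,
  for \<open>1\<close>, for \<open>m\<close> and for \<open>q\<^sup>m\<close>.
\<close>
definition box_sum :: "(nat \<Rightarrow> nat) \<Rightarrow> (int \<Rightarrow> 'a::comm_ring_1) \<Rightarrow> 'a" where
  "box_sum \<mu> g = (\<Sum>i = 1..part_length \<mu>. \<Sum>c = 1..\<mu> i. g (int c - int i))"

text \<open>
  For \<open>g m = t\<^sup>m\<close> this is the product
  \<open>(\<Sum>i. t\<^bsup>\<nu>\<^sub>i - i\<^esup> - t\<^bsup>- i\<^esup>) (\<Sum>j. t\<^bsup>j - \<mu>\<^sub>j\<^esup> - t\<^sup>j)\<close>.
\<close>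

definition cross_sum ::
  "(nat \<Rightarrow> nat) \<Rightarrow> (nat \<Rightarrow> nat) \<Rightarrow> (int \<Rightarrow> 'a::comm_ring_1) \<Rightarrow> 'a" where
  "cross_sum \<nu> \<mu> g = (\<Sum>i = 1..part_length \<nu>. \<Sum>j = 1..part_length \<mu>.
     g (int (\<nu> i) - int (\<mu> j) + int j - int i) - g (int (\<nu> i) + int j - int i)
     - g (int j - int i - int (\<mu> j)) + g (int j - int i))"

lemma partition_antimono:
  assumes "is_partition \<mu>" "1 \<le> i" "i \<le> j"
  shows "\<mu> j \<le> \<mu> i"
  using assms(3)
proof (induction j rule: dec_induct)
  case (step n)
  have "\<mu> (n + 1) \<le> \<mu> n"
    using assms(1,2) step.hyps by (auto simp: is_partition_def)
  with step.IH show ?case by simp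
qed simp

lemma partition_level_set:
  assumes "is_partition \<mu>" "1 \<le> j"
  shows "{i. i \<ge> 1 \<and> \<mu> i \<ge> j} = {1..transposed \<mu> j}"
proof -
  let ?S = "{i. i \<ge> 1 \<and> \<mu> i \<ge> j}"
  have fin: "finite ?S"
    by (rule finite_subset[of _ "{i. i \<ge> 1 \<and> \<mu> i \<noteq> 0}"])
      (use assms in \<open>auto simp: is_partition_def\<close>)
  show ?thesis
  proof (cases "?S = {}")
    case True
    then show ?thesis by (simp add: transposed_def del: Collect_empty_eq)
  next
    case False
    have "Max ?S \<in> ?S" using fin False by (rule Max_in)
    hence "?S = {1..Max ?S}"
      using partition_antimono[OF assms(1)] Max_ge[OF fin]
      by (auto intro: order_trans)
    moreover from this have "transposed \<mu> j = Max ?S"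
      unfolding transposed_def by (metis card_atLeastAtMost diff_Suc_1 One_nat_def)
    ultimately show ?thesis by simp
  qed
qed

lemma partition_support:
  assumes "is_partition \<mu>"
  shows "{i. i \<ge> 1 \<and> \<mu> i \<noteq> 0} = {1..part_length \<mu>}"
proof -
  have eq: "{i. i \<ge> 1 \<and> \<mu> i \<noteq> 0} = {i. i \<ge> 1 \<and> \<mu> i \<ge> 1}" by auto
  show ?thesis
    using partition_level_set[OF assms, of 1]
    unfolding part_length_def eq transposed_def by simp
qed

lemma partition_eq_0:
  assumes "is_partition \<mu>" "i > part_length \<mu>"
  shows "\<mu> i = 0"
proof (rule ccontr)
  assume "\<mu> i \<noteq> 0"
  hence "i \<in> {i. i \<ge> 1 \<and> \<mu> i \<noteq> 0}" using assms(2) by simp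
  thus False unfolding partition_support[OF assms(1)] using assms(2) by simp
qed

text \<open>
  The box in row \<open>i\<close> and column \<open>j\<close> of the diagram of \<open>\<mu>\<close> is the box in row \<open>j\<close> and
  column \<open>i\<close> of the transposed diagram, with opposite content; this is an interchange of summation.
  The upper bound \<open>\<mu> 1\<close> is the number of rows of the transposed diagram.
\<close>

lemma box_sum_transposed:
  assumes "is_partition \<mu>"
  shows "(\<Sum>j = 1..\<mu> 1. \<Sum>c = 1..transposed \<mu> j. g (int c - int j))
       = box_sum \<mu> (\<lambda>k. g (- k))"
proof -
  have lvl: "{i \<in> {1..part_length \<mu>}. j \<le> \<mu> i} = {1..transposed \<mu> j}" if "1 \<le> j" for j
  proof -
    have "i \<le> part_length \<mu>" if "i \<ge> 1" "j \<le> \<mu> i" for i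
      using partition_eq_0[OF assms, of i] that \<open>1 \<le> j\<close> by (cases "i \<le> part_length \<mu>") auto
    thus ?thesis
      unfolding partition_level_set[OF assms that, symmetric] by auto
  qed
  have row: "{j \<in> {1..\<mu> 1}. j \<le> \<mu> i} = {1..\<mu> i}" if "1 \<le> i" for i
    using partition_antimono[OF assms _ that] by auto
  have "(\<Sum>j = 1..\<mu> 1. \<Sum>c = 1..transposed \<mu> j. g (int c - int j))
      = (\<Sum>j = 1..\<mu> 1. \<Sum>i | i \<in> {1..part_length \<mu>} \<and> j \<le> \<mu> i. g (int i - int j))"
    by (intro sum.cong refl lvl[symmetric]) simp
  also have "\<dots> = (\<Sum>i = 1..part_length \<mu>. \<Sum>j | j \<in> {1..\<mu> 1} \<and> j \<le> \<mu> i. g (int i - int j))"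
    by (rule sum.swap_restrict[symmetric]) auto
  also have "\<dots> = (\<Sum>i = 1..part_length \<mu>. \<Sum>j = 1..\<mu> i. g (int i - int j))"
    by (intro sum.cong refl row) simp
  finally show ?thesis by (simp add: box_sum_def)
qed

section \<open>The exponents of the hyperbolic sines\<close>

lemma sum_of_bool_interval:
  fixes x :: int
  shows "(\<Sum>c = 1..n. of_bool (int c = x)) = (of_bool (1 \<le> x \<and> x \<le> int n) :: int)"
proof -
  have "(\<Sum>c = 1..n. of_bool (int c = x) :: int) = (\<Sum>c = 1..n. if c = nat x then of_bool (1 \<le> x) else 0)"
    by (intro sum.cong refl) auto
  also have "\<dots> = of_bool (1 \<le> x \<and> x \<le> int n)"
    by (subst sum.delta) auto
  finally show ?thesis .
qed

text \<open>
  Each summand \<open>t\<^bsup>\<nu>\<^sub>i - \<mu>\<^sub>j + j - i\<^esup> - t\<^bsup>j - i\<^esup>\<close> is split into its summand in the product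
  \<open>l(t) r(t)\<close>, a part that depends on \<open>j\<close> only through the factor \<open>t\<^sup>j\<close>, and a part that depends on
  \<open>i\<close> only through \<open>t\<^bsup>- i\<^esup>\<close>. For the coefficient of \<open>t\<^sup>m\<close>, the last two telescope along \<open>j\<close> and along \<open>i\<close>:
  what survives of row \<open>i\<close> of \<open>\<nu>\<close> is one term for each box of content \<open>m\<close>, with sign \<open>-1\<close>,
  and similarly for \<open>\<mu>\<close> and content \<open>- m\<close>.
\<close>

lemma e_coeff_expand:
  assumes "is_partition \<nu>" "is_partition \<mu>"
  shows "e_coeff \<nu> \<mu> m = cross_sum \<nu> \<mu> (\<lambda>x. of_bool (x = m))
           - box_sum \<nu> (\<lambda>x. of_bool (x = m)) - box_sum \<mu> (\<lambda>x. of_bool (- x = m))"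
proof -
  define S where "S = {(i, j). i \<ge> 1 \<and> j \<ge> 1 \<and> e_term \<nu> \<mu> m i j \<noteq> 0}"
  have "finite S" unfolding S_def using assms by (rule finite_e_term)
  \<comment> \<open>Truncating at \<open>K\<close> loses no pair that contributes, and \<open>K\<close> is at least \<open>i + \<bar>m\<bar>\<close> for every
      nonzero row \<open>i\<close>, so that the telescoping sums only see their lower boundary.\<close>
  define K where "K = part_length \<nu> + part_length \<mu> + nat \<bar>m\<bar> + (\<Sum>(i, j)\<in>S. i + j)"
  have KS: "S \<subseteq> {1..K} \<times> {1..K}"
  proof clarify
    fix i j assume ij: "(i, j) \<in> S"
    have "(case (i, j) of (i, j) \<Rightarrow> i + j) \<le> (\<Sum>(i, j)\<in>S. i + j)"
      using \<open>finite S\<close> ij by (intro member_le_sum) auto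
    thus "i \<in> {1..K} \<and> j \<in> {1..K}" using ij unfolding K_def by (auto simp: S_def)
  qed
  have "part_length \<nu> + nat \<bar>m\<bar> \<le> K" "part_length \<mu> + nat \<bar>m\<bar> \<le> K"
    by (simp_all add: K_def)
  hence K\<nu>: "int (part_length \<nu>) + \<bar>m\<bar> \<le> int K" and K\<mu>: "int (part_length \<mu>) + \<bar>m\<bar> \<le> int K"
    by linarith+
  define \<delta> where "\<delta> = (\<lambda>x. of_bool (x = m) :: int)"
  define X where "X = (\<lambda>i j. \<delta> (int (\<nu> i) - int (\<mu> j) + int j - int i) - \<delta> (int (\<nu> i) + int j - int i)
     - \<delta> (int j - int i - int (\<mu> j)) + \<delta> (int j - int i))"
  define R where "R = (\<lambda>i j. \<delta> (int (\<nu> i) + int j - int i) - \<delta> (int j - int i))"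
  define T where "T = (\<lambda>i j. \<delta> (int j - int i - int (\<mu> j)) - \<delta> (int j - int i))"

  have split: "e_term \<nu> \<mu> m i j = X i j + R i j + T i j" for i j
    by (simp add: e_term_def X_def R_def T_def \<delta>_def)
  have "e_coeff \<nu> \<mu> m = (\<Sum>(i, j)\<in>{1..K} \<times> {1..K}. e_term \<nu> \<mu> m i j)"
    unfolding e_coeff_def S_def[symmetric]
    by (rule sum.mono_neutral_left) (use KS in \<open>auto simp: S_def\<close>)
  also have "\<dots> = (\<Sum>i = 1..K. \<Sum>j = 1..K. X i j) + (\<Sum>i = 1..K. \<Sum>j = 1..K. R i j)
                 + (\<Sum>j = 1..K. \<Sum>i = 1..K. T i j)"
    unfolding split sum.cartesian_product[symmetric] sum.distrib
    by (simp add: sum.swap[of T])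
  also have "(\<Sum>i = 1..K. \<Sum>j = 1..K. X i j) = cross_sum \<nu> \<mu> \<delta>"
  proof -
    have "(\<Sum>i = 1..K. \<Sum>j = 1..K. X i j) = (\<Sum>(i, j)\<in>{1..K} \<times> {1..K}. X i j)"
      by (simp add: sum.cartesian_product)
    also have "\<dots> = (\<Sum>(i, j)\<in>{1..part_length \<nu>} \<times> {1..part_length \<mu>}. X i j)"
    proof (rule sum.mono_neutral_right)
      have X0: "X i j = 0" if "\<not> (i \<le> part_length \<nu> \<and> j \<le> part_length \<mu>)" for i j
        using that partition_eq_0[OF assms(1), of i] partition_eq_0[OF assms(2), of j]
        by (auto simp: X_def algebra_simps)
      show "\<forall>p\<in>{1..K} \<times> {1..K} - {1..part_length \<nu>} \<times> {1..part_length \<mu>}. (case p of (i, j) \<Rightarrow> X i j) = 0"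
      proof
        fix p assume "p \<in> {1..K} \<times> {1..K} - {1..part_length \<nu>} \<times> {1..part_length \<mu>}"
        thus "(case p of (i, j) \<Rightarrow> X i j) = 0"
          using X0[of "fst p" "snd p"] by (auto simp: split_beta mem_Times_iff)
      qed
    qed (auto simp: K_def)
    also have "\<dots> = cross_sum \<nu> \<mu> \<delta>"
      by (simp add: sum.cartesian_product cross_sum_def X_def)
    finally show ?thesis .
  qed
  also have "(\<Sum>i = 1..K. \<Sum>j = 1..K. R i j) = - box_sum \<nu> \<delta>"
  proof -
    have "(\<Sum>i = 1..K. \<Sum>j = 1..K. R i j) = (\<Sum>i = 1..part_length \<nu>. \<Sum>j = 1..K. R i j)"
      by (rule sum.mono_neutral_right)
        (use partition_eq_0[OF assms(1)] in \<open>auto simp: K_def R_def not_le\<close>)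
    also have "\<dots> = (\<Sum>i = 1..part_length \<nu>. - (\<Sum>c = 1..\<nu> i. \<delta> (int c - int i)))"
    proof (intro sum.cong refl)
      fix i assume i: "i \<in> {1..part_length \<nu>}"
      have "(\<Sum>j = 1..K. R i j) = (\<Sum>j = 1..K. of_bool (int j = m + int i - int (\<nu> i)))
              - (\<Sum>j = 1..K. of_bool (int j = m + int i))"
        unfolding sum_subtractf[symmetric] R_def \<delta>_def
        by (intro sum.cong refl arg_cong2[of _ _ _ _ "(-)"] arg_cong[of _ _ of_bool]) auto
      also have "\<dots> = - of_bool (1 \<le> m + int i \<and> m + int i \<le> int (\<nu> i))"
        unfolding sum_of_bool_interval using i K\<nu> by auto
      also have "\<dots> = - (\<Sum>c = 1..\<nu> i. of_bool (int c = m + int i))"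
        by (simp only: sum_of_bool_interval)
      finally show "(\<Sum>j = 1..K. R i j) = - (\<Sum>c = 1..\<nu> i. \<delta> (int c - int i))"
        by (simp add: \<delta>_def diff_eq_eq)
    qed
    finally show ?thesis by (simp add: box_sum_def sum_negf)
  qed
  also have "(\<Sum>j = 1..K. \<Sum>i = 1..K. T i j) = - box_sum \<mu> (\<lambda>x. \<delta> (- x))"
  proof -
    have "(\<Sum>j = 1..K. \<Sum>i = 1..K. T i j) = (\<Sum>j = 1..part_length \<mu>. \<Sum>i = 1..K. T i j)"
      by (rule sum.mono_neutral_right)
        (use partition_eq_0[OF assms(2)] in \<open>auto simp: K_def T_def not_le\<close>)
    also have "\<dots> = (\<Sum>j = 1..part_length \<mu>. - (\<Sum>c = 1..\<mu> j. \<delta> (int j - int c)))"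
    proof (intro sum.cong refl)
      fix j assume j: "j \<in> {1..part_length \<mu>}"
      have "(\<Sum>i = 1..K. T i j) = (\<Sum>i = 1..K. of_bool (int i = int j - int (\<mu> j) - m))
              - (\<Sum>i = 1..K. of_bool (int i = int j - m))"
        unfolding sum_subtractf[symmetric] T_def \<delta>_def
        by (intro sum.cong refl arg_cong2[of _ _ _ _ "(-)"] arg_cong[of _ _ of_bool]) auto
      also have "\<dots> = - of_bool (1 \<le> int j - m \<and> int j - m \<le> int (\<mu> j))"
        unfolding sum_of_bool_interval using j K\<mu> by auto
      also have "\<dots> = - (\<Sum>c = 1..\<mu> j. of_bool (int c = int j - m))"
        by (simp only: sum_of_bool_interval)
      also have "(\<Sum>c = 1..\<mu> j. of_bool (int c = int j - m)) = (\<Sum>c = 1..\<mu> j. \<delta> (int j - int c))"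
        unfolding \<delta>_def by (intro sum.cong refl arg_cong[of _ _ of_bool]) auto
      finally show "(\<Sum>i = 1..K. T i j) = - (\<Sum>c = 1..\<mu> j. \<delta> (int j - int c))" .
    qed
    finally show ?thesis by (simp add: box_sum_def sum_negf)
  qed
  finally show ?thesis by (simp add: \<delta>_def)
qed

text \<open>
  Since \<open>g x = (\<Sum>m\<in>M. of_bool (x = m) * g m)\<close> for every finite \<open>M\<close> that contains \<open>x\<close>, the expansion
  for indicator functions implies the one for \<open>g\<close> by linearity.
\<close>

lemma e_coeff_pairing:
  fixes g :: "int \<Rightarrow> 'a::comm_ring_1"
  assumes "is_partition \<nu>" "is_partition \<mu>"
  shows "finite {m. e_coeff \<nu> \<mu> m \<noteq> 0}"
    and "(\<Sum>m | e_coeff \<nu> \<mu> m \<noteq> 0. of_int (e_coeff \<nu> \<mu> m) * g m)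
       = cross_sum \<nu> \<mu> g - box_sum \<nu> g - box_sum \<mu> (\<lambda>x. g (- x))"
proof -
  let ?I = "{1..part_length \<nu>}" and ?J = "{1..part_length \<mu>}"
  \<comment> \<open>A crude bound for the absolute value of all exponents that occur.\<close>
  define B where "B = part_length \<nu> + part_length \<mu> + sum \<nu> ?I + sum \<mu> ?J"
  define M where "M = {- int B..int B}"
  have \<nu>: "i + \<nu> i \<le> B" if "i \<in> ?I" for i
    using member_le_sum[of i ?I \<nu>] that by (auto simp: B_def)
  have \<mu>: "j + \<mu> j \<le> B" if "j \<in> ?J" for j
    using member_le_sum[of j ?J \<mu>] that by (auto simp: B_def)
  have \<nu>\<mu>: "i + \<nu> i + j + \<mu> j \<le> B" if "i \<in> ?I" "j \<in> ?J" for i j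
    using member_le_sum[of i ?I \<nu>] member_le_sum[of j ?J \<mu>] that by (auto simp: B_def)
  have off: "e_coeff \<nu> \<mu> m = 0" if "m \<notin> M" for m
  proof -
    have m: "m < - int B \<or> m > int B" using that by (auto simp: M_def)
    have "cross_sum \<nu> \<mu> (\<lambda>x. of_bool (x = m) :: int) = 0"
      unfolding cross_sum_def
    proof (intro sum.neutral ballI)
      fix i j assume "i \<in> ?I" "j \<in> ?J"
      hence "int (\<nu> i) - int (\<mu> j) + int j - int i \<noteq> m" "int (\<nu> i) + int j - int i \<noteq> m"
        "int j - int i - int (\<mu> j) \<noteq> m" "int j - int i \<noteq> m"
        using \<nu>\<mu>[of i j] m by linarith+
      thus "of_bool (int (\<nu> i) - int (\<mu> j) + int j - int i = m)
          - of_bool (int (\<nu> i) + int j - int i = m)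
          - of_bool (int j - int i - int (\<mu> j) = m) + of_bool (int j - int i = m) = (0 :: int)"
        by simp
    qed
    moreover have "int c - int i \<noteq> m" if "i \<in> ?I" "c \<in> {1..\<nu> i}" for i c
      using \<nu>[OF that(1)] that(2) m by auto
    hence "box_sum \<nu> (\<lambda>x. of_bool (x = m) :: int) = 0"
      unfolding box_sum_def by (intro sum.neutral ballI) simp
    moreover have "- (int c - int j) \<noteq> m" if "j \<in> ?J" "c \<in> {1..\<mu> j}" for j c
      using \<mu>[OF that(1)] that(2) m by auto
    hence "box_sum \<mu> (\<lambda>x. of_bool (- x = m) :: int) = 0"
      unfolding box_sum_def by (intro sum.neutral ballI) simp
    ultimately show ?thesis by (simp add: e_coeff_expand[OF assms])
  qed
  hence sub: "{m. e_coeff \<nu> \<mu> m \<noteq> 0} \<subseteq> M" by auto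
  thus "finite {m. e_coeff \<nu> \<mu> m \<noteq> 0}"
    by (rule finite_subset) (simp add: M_def)
  have pick: "(\<Sum>m\<in>M. of_bool (x = m) * g m) = g x" if "x \<in> M" for x
  proof -
    have "(\<Sum>m\<in>M. of_bool (x = m) * g m) = (\<Sum>m\<in>M. if x = m then g m else 0)"
      by (intro sum.cong) auto
    thus ?thesis using that by (simp add: M_def)
  qed
  have cr: "(\<Sum>m\<in>M. of_int (cross_sum \<nu> \<mu> (\<lambda>x. of_bool (x = m))) * g m) = cross_sum \<nu> \<mu> g"
  proof -
    have "(\<Sum>m\<in>M. of_int (cross_sum \<nu> \<mu> (\<lambda>x. of_bool (x = m))) * g m)
        = (\<Sum>i\<in>?I. \<Sum>j\<in>?J. \<Sum>m\<in>M.
             of_bool (int (\<nu> i) - int (\<mu> j) + int j - int i = m) * g m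
           - of_bool (int (\<nu> i) + int j - int i = m) * g m
           - of_bool (int j - int i - int (\<mu> j) = m) * g m + of_bool (int j - int i = m) * g m)"
      unfolding cross_sum_def of_int_sum sum_distrib_right
      apply (subst sum.swap[where A = M])
      apply (rule sum.cong[OF refl])
      apply (subst sum.swap[where A = M])
      apply (intro sum.cong refl)
      apply (simp only: of_int_add of_int_diff of_int_of_bool distrib_right left_diff_distrib)
      done
    also have "\<dots> = cross_sum \<nu> \<mu> g"
      unfolding cross_sum_def sum.distrib sum_subtractf
      apply (intro arg_cong2[of _ _ _ _ "(+)"] arg_cong2[of _ _ _ _ "(-)"] sum.cong refl pick)
      subgoal for i j using \<nu>\<mu>[of i j] by (simp add: M_def)
      subgoal for i j using \<nu>\<mu>[of i j] by (simp add: M_def)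
      subgoal for i j using \<nu>\<mu>[of i j] by (simp add: M_def)
      subgoal for i j using \<nu>\<mu>[of i j] by (simp add: M_def)
      done
    finally show ?thesis .
  qed
  have b1: "(\<Sum>m\<in>M. of_int (box_sum \<nu> (\<lambda>x. of_bool (x = m))) * g m) = box_sum \<nu> g"
    unfolding box_sum_def of_int_sum sum_distrib_right
    apply (subst sum.swap[where A = M])
    apply (rule sum.cong[OF refl])
    apply (subst sum.swap[where A = M])
    apply (rule sum.cong[OF refl])
    subgoal for i c
      unfolding of_int_of_bool by (rule pick) (use \<nu>[of i] in \<open>simp add: M_def\<close>)
    done
  have b2: "(\<Sum>m\<in>M. of_int (box_sum \<mu> (\<lambda>x. of_bool (- x = m))) * g m) = box_sum \<mu> (\<lambda>x. g (- x))"
    unfolding box_sum_def of_int_sum sum_distrib_right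
    apply (subst sum.swap[where A = M])
    apply (rule sum.cong[OF refl])
    apply (subst sum.swap[where A = M])
    apply (rule sum.cong[OF refl])
    subgoal for i c
      unfolding of_int_of_bool by (rule pick) (use \<mu>[of i] in \<open>simp add: M_def\<close>)
    done
  have "(\<Sum>m | e_coeff \<nu> \<mu> m \<noteq> 0. of_int (e_coeff \<nu> \<mu> m) * g m)
      = (\<Sum>m\<in>M. of_int (e_coeff \<nu> \<mu> m) * g m)"
    by (rule sum.mono_neutral_left) (use sub in \<open>auto simp: M_def\<close>)
  also have "\<dots> = cross_sum \<nu> \<mu> g - box_sum \<nu> g - box_sum \<mu> (\<lambda>x. g (- x))"
    by (simp add: e_coeff_expand[OF assms] left_diff_distrib sum_subtractf cr b1 b2)
  finally show "(\<Sum>m | e_coeff \<nu> \<mu> m \<noteq> 0. of_int (e_coeff \<nu> \<mu> m) * g m)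
       = cross_sum \<nu> \<mu> g - box_sum \<nu> g - box_sum \<mu> (\<lambda>x. g (- x))" .
qed

lemma part_size_eq:
  assumes "is_partition \<mu>"
  shows "part_size \<mu> = (\<Sum>i = 1..part_length \<mu>. \<mu> i)"
  unfolding part_size_def partition_support[OF assms] ..

lemma box_sum_content: "2 * box_sum \<mu> (\<lambda>x. x) = kappa \<mu>"
proof -
  have "2 * (\<Sum>c = 1..n. int c - int i) = int n * (int n - 2 * int i + 1)" for n i
    by (induction n) (simp_all add: algebra_simps)
  thus ?thesis by (simp add: box_sum_def kappa_def sum_distrib_left)
qed

lemma sum_e_coeff:
  assumes "is_partition \<nu>" "is_partition \<mu>"
  shows "(\<Sum>m | e_coeff \<nu> \<mu> m \<noteq> 0. e_coeff \<nu> \<mu> m) = - int (part_size \<nu>) - int (part_size \<mu>)"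
  using e_coeff_pairing(2)[OF assms, of "\<lambda>_. 1 :: int"]
  by (simp add: cross_sum_def box_sum_def part_size_eq assms)

lemma sum_e_coeff_moment:
  assumes "is_partition \<nu>" "is_partition \<mu>"
  shows "2 * (\<Sum>m | e_coeff \<nu> \<mu> m \<noteq> 0. e_coeff \<nu> \<mu> m * m) = kappa \<mu> - kappa \<nu>"
proof -
  have "cross_sum \<nu> \<mu> (\<lambda>x. x :: int) = 0" by (simp add: cross_sum_def)
  moreover have "box_sum \<mu> (\<lambda>x. - x) = - box_sum \<mu> (\<lambda>x. x :: int)"
    unfolding box_sum_def by (simp only: sum_negf)
  ultimately show ?thesis
    using e_coeff_pairing(2)[OF assms, of "\<lambda>x. x :: int"]
    by (simp add: box_sum_content[symmetric])
qed

section \<open>The coefficients of the Laurent polynomial\<close>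

lemma geometric_powi:
  fixes q :: "'a::field"
  assumes "q \<noteq> 0"
  shows "(q - 1) * (\<Sum>c = 1..n. q powi (int c - k)) = q * (q powi (int n - k) - q powi (- k))"
    and "(q - 1) * (\<Sum>c = 1..n. q powi (k - int c)) = q powi k - q powi (k - int n)"
proof -
  have s: "q powi (x + 1) = q * q powi x" for x using assms by (simp add: power_int_add)
  show "(q - 1) * (\<Sum>c = 1..n. q powi (int c - k)) = q * (q powi (int n - k) - q powi (- k))"
  proof (induction n)
    case (Suc n)
    have "q powi (int (Suc n) - k) = q * q powi (int n - k)" using s[of "int n - k"] by (simp add: algebra_simps)
    with Suc show ?case by (simp add: algebra_simps)
  qed simp
  show "(q - 1) * (\<Sum>c = 1..n. q powi (k - int c)) = q powi k - q powi (k - int n)"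
  proof (induction n)
    case (Suc n)
    have "q powi (k - int n) = q * q powi (k - int (Suc n))" using s[of "k - int (Suc n)"] by (simp add: algebra_simps)
    with Suc show ?case by (simp add: algebra_simps)
  qed simp
qed

text \<open>
  The series differs from the geometric series \<open>\<Sum>i. q\<^bsup>- i\<^esup> = 1 / (q - 1)\<close> in finitely many terms.
\<close>

lemma infsum_powi:
  fixes q :: complex
  assumes q: "norm q > 1" and zero: "\<And>i. i > N \<Longrightarrow> \<nu> i = (0::nat)"
  shows "(\<Sum>\<^sub>\<infinity>i\<in>{1..}. q powi (int (\<nu> i) - int i))
       = 1 / (q - 1) + (\<Sum>i = 1..N. q powi (int (\<nu> i) - int i) - q powi (- int i))"
proof -
  have q0: "q \<noteq> 0" "q \<noteq> 1" using q by auto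
  have "norm (inverse q) < 1" using q by (simp add: norm_inverse inverse_less_1_iff)
  have "((\<lambda>i. inverse q ^ i) has_sum (1 / (1 - inverse q))) UNIV"
    using \<open>norm (inverse q) < 1\<close>
    by (intro norm_summable_imp_has_sum geometric_sums)
      (simp_all add: norm_power summable_geometric)
  hence "((\<lambda>i. inverse q ^ i) has_sum (1 / (1 - inverse q) - inverse q ^ 0)) (UNIV - {0})"
    by (intro has_sum_Diff has_sum_finite[of "{0}", simplified]) auto
  moreover have "UNIV - {0} = {1::nat..}" by auto
  moreover have "1 / (1 - inverse q) - inverse q ^ 0 = 1 / (q - 1)"
    using q0 by (simp add: field_simps)
  moreover have "(\<lambda>i. inverse q ^ i) = (\<lambda>i. q powi (- int i))"
    by (simp add: power_int_minus power_inverse)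
  ultimately have geo: "((\<lambda>i. q powi (- int i)) has_sum (1 / (q - 1))) {1..}"
    by simp
  have "((\<lambda>i. q powi (int (\<nu> i) - int i) - q powi (- int i)) has_sum
      (\<Sum>i = 1..N. q powi (int (\<nu> i) - int i) - q powi (- int i))) {1..N}"
    by (rule has_sum_finite) simp
  hence "((\<lambda>i. q powi (int (\<nu> i) - int i) - q powi (- int i)) has_sum
      (\<Sum>i = 1..N. q powi (int (\<nu> i) - int i) - q powi (- int i))) {1..}"
    by (rule has_sum_cong_neutral[THEN iffD1, rotated -1]) (auto simp: zero)
  from has_sum_add[OF geo this] show ?thesis by (auto intro: infsumI)
qed

text \<open>
  With \<open>l\<close> and \<open>t\<close> the finite corrections to the two geometric series, \<open>f(q)\<close> equals
  \<open>q l / (q - 1) + q t / (q - 1) + l (q t)\<close>. The first two terms are sums over boxes. Summing over the boxes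
  of \<open>\<mu>\<close> by rows instead of columns gives \<open>q t = - (\<Sum>j. q\<^bsup>j - \<mu>\<^sub>j\<^esup> - q\<^sup>j)\<close>, which explains both the
  double sum and its sign.
\<close>

lemma f_series_transposed:
  fixes q :: complex
  assumes \<nu>: "is_partition \<nu>" and \<mu>: "is_partition \<mu>" and q: "norm q > 1"
  shows "f_series \<nu> (transposed \<mu>) q
       = box_sum \<nu> (\<lambda>k. q powi k) + box_sum \<mu> (\<lambda>k. q powi (- k)) - cross_sum \<nu> \<mu> (\<lambda>k. q powi k)"
proof -
  have q0: "q \<noteq> 0" and q1: "q - 1 \<noteq> 0" using q by auto
  define l where "l = (\<Sum>i = 1..part_length \<nu>. q powi (int (\<nu> i) - int i) - q powi (- int i))"
  define m where "m = (\<Sum>j = 1..part_length \<mu>. q powi (int j - int (\<mu> j)) - q powi int j)"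
  define t where "t = (\<Sum>j = 1..\<mu> 1. q powi (int (transposed \<mu> j) - int j) - q powi (- int j))"
  have "transposed \<mu> j = 0" if "j > \<mu> 1" for j
  proof -
    have "{i. i \<ge> 1 \<and> \<mu> i \<ge> j} = {}"
      using partition_antimono[OF \<mu>, of 1] that by fastforce
    thus ?thesis by (simp add: transposed_def del: Collect_empty_eq)
  qed
  hence sum_t: "(\<Sum>\<^sub>\<infinity>j\<in>{1..}. q powi (int (transposed \<mu> j) - int j)) = 1 / (q - 1) + t"
    unfolding t_def by (intro infsum_powi q)
  have sum_l: "(\<Sum>\<^sub>\<infinity>i\<in>{1..}. q powi (int (\<nu> i) - int i)) = 1 / (q - 1) + l"
    unfolding l_def by (intro infsum_powi q partition_eq_0[OF \<nu>])
  have sum_0: "(\<Sum>\<^sub>\<infinity>i\<in>{1..}. q powi (- int i)) = 1 / (q - 1)"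
    using infsum_powi[OF q, of 0 "\<lambda>_. 0"] by simp
  have bl: "(q - 1) * box_sum \<nu> (\<lambda>k. q powi k) = q * l"
    by (simp only: box_sum_def l_def sum_distrib_left[of _ _ "{1..part_length \<nu>}"]
          geometric_powi(1)[OF q0])
  have bt: "(q - 1) * box_sum \<mu> (\<lambda>k. q powi (- k)) = q * t"
    by (simp only: box_sum_transposed[OF \<mu>, symmetric] t_def sum_distrib_left[of _ _ "{1..\<mu> 1}"]
          geometric_powi(1)[OF q0])
  have "(q - 1) * box_sum \<mu> (\<lambda>k. q powi (- k))
      = (\<Sum>j = 1..part_length \<mu>. q powi int j - q powi (int j - int (\<mu> j)))"
    by (simp only: box_sum_def minus_diff_eq sum_distrib_left[of _ _ "{1..part_length \<mu>}"]
          geometric_powi(2)[OF q0])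
  also have "\<dots> = - m"
    unfolding m_def sum_negf[symmetric] by simp
  finally have mt: "q * t = - m" using bt by simp
  have cr: "cross_sum \<nu> \<mu> (\<lambda>k. q powi k) = l * m"
  proof -
    have factor: "q powi (x + y) - q powi (x + v) - q powi (u + y) + q powi (u + v)
        = (q powi x - q powi u) * (q powi y - q powi v)" for x y u v
      using q0 by (simp add: power_int_add algebra_simps)
    have "q powi (int (\<nu> i) - int (\<mu> j) + int j - int i) - q powi (int (\<nu> i) + int j - int i)
     - q powi (int j - int i - int (\<mu> j)) + q powi (int j - int i)
     = (q powi (int (\<nu> i) - int i) - q powi (- int i)) * (q powi (int j - int (\<mu> j)) - q powi int j)"
      for i j
    proof -
      have "int (\<nu> i) - int (\<mu> j) + int j - int i = (int (\<nu> i) - int i) + (int j - int (\<mu> j))"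
        "int (\<nu> i) + int j - int i = (int (\<nu> i) - int i) + int j"
        "int j - int i - int (\<mu> j) = - int i + (int j - int (\<mu> j))"
        "int j - int i = - int i + int j"
        by simp_all
      thus ?thesis by (simp only: factor)
    qed
    thus ?thesis unfolding cross_sum_def l_def m_def sum_product by (intro sum.cong refl)
  qed
  have "f_series \<nu> (transposed \<mu>) q = (q * l) / (q - 1) + (q * t) / (q - 1) + l * (q * t)"
    unfolding f_series_def sum_t sum_l sum_0 by (simp add: algebra_simps)
  also have "(q * l) / (q - 1) = box_sum \<nu> (\<lambda>k. q powi k)"
    unfolding bl[symmetric] using q1 by simp
  also have "(q * t) / (q - 1) = box_sum \<mu> (\<lambda>k. q powi (- k))"
    unfolding bt[symmetric] using q1 by simp
  finally show ?thesis by (simp add: mt cr)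
qed

text \<open>
  After multiplication by a power of \<open>q\<close>, the difference of the two sums is a polynomial that
  vanishes at infinitely many points.
\<close>

lemma laurent_coeffs_unique:
  fixes c d :: "int \<Rightarrow> int"
  assumes fin: "finite {k. c k \<noteq> 0}" "finite {k. d k \<noteq> 0}"
    and eq: "\<And>q :: complex. norm q > 1 \<Longrightarrow>
      (\<Sum>k | c k \<noteq> 0. of_int (c k) * q powi k) = (\<Sum>k | d k \<noteq> 0. of_int (d k) * q powi k)"
  shows "c = d"
proof
  fix k0
  define S where "S = {k. c k \<noteq> 0} \<union> {k. d k \<noteq> 0}"
  have S: "finite S" using fin by (simp add: S_def)
  \<comment> \<open>The shift that makes all exponents nonnegative. The index \<open>k0\<close> is included so that the
      coefficient at \<open>k0\<close> can be read off even when \<open>k0\<close> lies outside both supports.\<close>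
  define B where "B = - Min (insert k0 S)"
  have B: "k + B \<ge> 0" if "k \<in> insert k0 S" for k
  proof -
    have "Min (insert k0 S) \<le> k" using S that by (intro Min_le) simp_all
    thus ?thesis unfolding B_def by linarith
  qed
  define p :: "complex poly" where "p = (\<Sum>k\<in>S. monom (of_int (c k - d k)) (nat (k + B)))"
  have "poly p q = 0" if q: "norm q > 1" for q
  proof -
    have "q \<noteq> 0" using q by auto
    have "poly p q = (\<Sum>k\<in>S. of_int (c k - d k) * (q powi k * q powi B))"
      unfolding p_def poly_sum poly_monom
    proof (intro sum.cong refl arg_cong2[of _ _ _ _ "(*)"])
      fix k assume "k \<in> S"
      hence "q ^ nat (k + B) = q powi (k + B)" using B[of k] by (simp add: power_int_def)
      thus "q ^ nat (k + B) = q powi k * q powi B" using \<open>q \<noteq> 0\<close> by (simp add: power_int_add)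
    qed
    also have "\<dots> = ((\<Sum>k\<in>S. of_int (c k) * q powi k) - (\<Sum>k\<in>S. of_int (d k) * q powi k)) * q powi B"
      by (simp add: left_diff_distrib sum_subtractf sum_distrib_right mult.assoc)
    also have "(\<Sum>k\<in>S. of_int (c k) * q powi k) = (\<Sum>k | c k \<noteq> 0. of_int (c k) * q powi k)"
      by (rule sum.mono_neutral_right) (use S in \<open>auto simp: S_def\<close>)
    also have "(\<Sum>k\<in>S. of_int (d k) * q powi k) = (\<Sum>k | d k \<noteq> 0. of_int (d k) * q powi k)"
      by (rule sum.mono_neutral_right) (use S in \<open>auto simp: S_def\<close>)
    finally show ?thesis using eq[OF q] by simp
  qed
  moreover have "norm (of_nat (n + 2) :: complex) > 1" for n
    unfolding norm_of_nat by simp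
  ultimately have "range (\<lambda>n::nat. of_nat (n + 2)) \<subseteq> {q. poly p q = 0}"
    by blast
  moreover have "infinite (range (\<lambda>n::nat. of_nat (n + 2) :: complex))"
    by (rule range_inj_infinite) (auto simp: inj_def)
  ultimately have "p = 0"
    using poly_roots_finite finite_subset by blast
  hence "0 = coeff p (nat (k0 + B))" by simp
  also have "\<dots> = (\<Sum>k\<in>S. if k = k0 then of_int (c k - d k) else 0)"
    unfolding p_def coeff_sum coeff_monom
  proof (intro sum.cong refl if_cong)
    fix k assume "k \<in> S"
    thus "(nat (k + B) = nat (k0 + B)) = (k = k0)" using B[of k] B[of k0] by auto
  qed
  also have "\<dots> = of_int (c k0 - d k0)"
    using S by (auto simp: S_def)
  finally show "c k0 = d k0" by (metis eq_iff_diff_eq_0 of_int_eq_0_iff)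
qed

lemma C_coeff_eq:
  assumes "is_partition \<nu>" "is_partition \<mu>"
  shows "C_coeff \<nu> (transposed \<mu>) = (\<lambda>k. - e_coeff \<nu> \<mu> k)"
proof -
  note e = e_coeff_pairing[OF assms]
  have f: "f_series \<nu> (transposed \<mu>) q
      = (\<Sum>k | - e_coeff \<nu> \<mu> k \<noteq> 0. of_int (- e_coeff \<nu> \<mu> k) * q powi k)" if "norm q > 1" for q
    using e(2)[of "\<lambda>k. q powi k"] f_series_transposed[OF assms that]
    by (simp add: sum_negf)
  show ?thesis
    unfolding C_coeff_def
  proof (rule the_equality)
    fix c :: "int \<Rightarrow> int"
    assume c: "finite {k. c k \<noteq> 0} \<and> (\<forall>q. norm q > 1 \<longrightarrow>
      f_series \<nu> (transposed \<mu>) q = (\<Sum>k | c k \<noteq> 0. of_int (c k) * q powi k))"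
    show "c = (\<lambda>k. - e_coeff \<nu> \<mu> k)"
    proof (rule laurent_coeffs_unique)
      fix q :: complex assume "norm q > 1"
      then show "(\<Sum>k | c k \<noteq> 0. of_int (c k) * q powi k)
        = (\<Sum>k | - e_coeff \<nu> \<mu> k \<noteq> 0. of_int (- e_coeff \<nu> \<mu> k) * q powi k)"
        using c f by (metis (no_types, lifting))
    qed (use c e(1) in auto)
  qed (use e(1) f in auto)
qed

section \<open>Comparison of the products\<close>

lemma sinh_square:
  fixes x :: complex
  shows "(sinh x)\<^sup>2 = (1 - exp (- 2 * x))\<^sup>2 / (4 * exp (- 2 * x))"
proof -
  have y: "exp (- 2 * x) = (exp (- x))\<^sup>2" by (simp add: exp_double[symmetric])
  have "sinh x = (inverse (exp (- x)) - exp (- x)) / 2"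
    by (simp add: sinh_field_def exp_minus)
  also have "\<dots> = (1 - (exp (- x))\<^sup>2) / (2 * exp (- x))"
    using exp_not_eq_zero[of "- x"] by (simp only: power2_eq_square) (simp add: divide_simps)
  finally show ?thesis
    unfolding y by (simp only: power_divide power_mult_distrib) simp
qed

lemma prod_powi_exponent:
  fixes z :: "'a::field"
  assumes "z \<noteq> 0"
  shows "(\<Prod>i\<in>A. z powi f i) = z powi (\<Sum>i\<in>A. f i)"
  by (induction A rule: infinite_finite_induct) (use assms in \<open>auto simp: power_int_add\<close>)

theorem corollary7p1:
  fixes mu :: "nat \<Rightarrow> nat \<Rightarrow> nat"
    and A :: "nat \<Rightarrow> nat \<Rightarrow> complex"
    and a \<beta> h Q q :: complex
  assumes "is_partition (mu 1)" and "is_partition (mu 2)"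
    and "A 1 2 = 2 * a" and "A 2 1 = - (2 * a)"
    and "Q = exp (- 2 * a * \<beta>)" and "q = exp (- \<beta> * h)"
    and generic: "\<And>m :: int. sinh (\<beta> / 2 * (2 * a + h * of_int m)) \<noteq> 0"
  shows "(\<Prod>k | C_coeff (mu 1) (transposed (mu 2)) k \<noteq> 0.
            (1 - q powi k * Q) powi (- 2 * C_coeff (mu 1) (transposed (mu 2)) k))
       = Q powi (- int (part_size (mu 1)) - int (part_size (mu 2)))
         * 2 powi (- 2 * (int (part_size (mu 1)) + int (part_size (mu 2))))
         * q powr (- (1 / 2) * of_int (kappa (mu 1) - kappa (mu 2)))
         * (\<Prod>(l, n) \<in> {(l, n). l \<in> {1, 2} \<and> n \<in> {1, 2} \<and> l \<noteq> n}. sinh_product \<beta> h A mu l n)"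
proof -
  define e where "e = e_coeff (mu 1) (mu 2)"
  define S where "S = {m. e m \<noteq> 0}"
  define N where "N = int (part_size (mu 1)) + int (part_size (mu 2))"
  define s where "s = (\<lambda>m::int. sinh (\<beta> / 2 * (2 * a + h * of_int m)))"
  have nz: "Q \<noteq> 0" "q \<noteq> 0" using assms by auto
  have sum_e: "(\<Sum>m\<in>S. e m) = - N"
    unfolding S_def e_def N_def using sum_e_coeff[OF assms(1,2)] by simp
  have moment: "2 * (\<Sum>m\<in>S. e m * m) = kappa (mu 2) - kappa (mu 1)"
    unfolding S_def e_def by (rule sum_e_coeff_moment[OF assms(1,2)])
  \<comment> \<open>The difference of the \<open>\<kappa>\<close>'s is even, so the power is an integral one and does not depend on
      the branch of the logarithm.\<close>
  have powr: "q powr (- (1 / 2) * of_int (kappa (mu 1) - kappa (mu 2))) = q powi (\<Sum>m\<in>S. e m * m)"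
  proof -
    have "- (1 / 2) * of_int (kappa (mu 1) - kappa (mu 2)) = (of_int (\<Sum>m\<in>S. e m * m) :: complex)"
      using arg_cong[OF moment, of "of_int :: int \<Rightarrow> complex"] by (simp add: field_simps del: of_int_sum)
    thus ?thesis using nz by (simp add: complex_powr_of_int del: of_int_sum)
  qed
  have sq: "s m * s m = (1 - q powi m * Q)\<^sup>2 * inverse (4 * Q * q powi m)" for m
  proof -
    have "exp (- 2 * (\<beta> / 2 * (2 * a + h * of_int m))) = exp (of_int m * (- \<beta> * h)) * exp (- 2 * a * \<beta>)"
      unfolding exp_add[symmetric] by (simp add: algebra_simps)
    also have "\<dots> = q powi m * Q"
      by (simp only: exp_power_int[symmetric] assms)
    finally have "exp (- 2 * (\<beta> / 2 * (2 * a + h * of_int m))) = q powi m * Q" .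
    thus ?thesis
      unfolding s_def power2_eq_square[symmetric] sinh_square
      by (simp only: divide_inverse mult.assoc mult.commute[of Q])
  qed
  have "{(l, n). l \<in> {1, 2} \<and> n \<in> {1, 2} \<and> l \<noteq> n} = {(1, 2), (2, 1 :: nat)}" by auto
  moreover have "min 1 2 = (1::nat)" "max 1 2 = (2::nat)" "min 2 1 = (1::nat)" "max 2 1 = (2::nat)"
    by simp_all
  hence "sinh_product \<beta> h A mu 1 2 = (\<Prod>m\<in>S. s m powi e m)"
    "sinh_product \<beta> h A mu 2 1 = (\<Prod>m\<in>S. s m powi e m)"
    by (simp_all only: sinh_product_def Let_def S_def e_def s_def assms(3))
  ultimately have "(\<Prod>(l, n) \<in> {(l, n). l \<in> {1, 2} \<and> n \<in> {1, 2} \<and> l \<noteq> n}. sinh_product \<beta> h A mu l n)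
      = (\<Prod>m\<in>S. s m powi e m) * (\<Prod>m\<in>S. s m powi e m)"
    by simp
  also have "\<dots> = (\<Prod>m\<in>S. (1 - q powi m * Q) powi (2 * e m) * ((4 * Q) powi (- e m) * q powi (- (e m * m))))"
    unfolding prod.distrib[symmetric]
  proof (intro prod.cong refl)
    fix m
    have "s m powi e m * s m powi e m = (s m * s m) powi e m"
      by (simp add: power_int_mult_distrib)
    also have "\<dots> = (1 - q powi m * Q) powi (2 * e m) * ((4 * Q) powi (- e m) * (q powi m) powi (- e m))"
      unfolding sq power_int_mult_distrib power_int_inverse power_int_mult
      by (simp add: power_int_minus power_int_mult_distrib power_int_numeral)
    also have "(q powi m) powi (- e m) = q powi (- (e m * m))"
      by (simp add: power_int_mult[symmetric] mult.commute)
    finally show "s m powi e m * s m powi e m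
      = (1 - q powi m * Q) powi (2 * e m) * ((4 * Q) powi (- e m) * q powi (- (e m * m)))" .
  qed
  also have "\<dots> = (\<Prod>m\<in>S. (1 - q powi m * Q) powi (2 * e m))
      * ((4 * Q) powi N * q powi (- (\<Sum>m\<in>S. e m * m)))"
    using nz by (simp add: prod.distrib prod_powi_exponent sum_negf sum_e)
  finally have P: "(\<Prod>(l, n) \<in> {(l, n). l \<in> {1, 2} \<and> n \<in> {1, 2} \<and> l \<noteq> n}. sinh_product \<beta> h A mu l n)
      = (\<Prod>m\<in>S. (1 - q powi m * Q) powi (2 * e m))
        * ((4 * Q) powi N * q powi (- (\<Sum>m\<in>S. e m * m)))" .
  have four: "(2 :: complex) powi (- 2 * N) = inverse (4 powi N)"
    by (simp add: power_int_minus power_int_mult power_int_numeral)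
  have L: "(\<Prod>k | C_coeff (mu 1) (transposed (mu 2)) k \<noteq> 0.
            (1 - q powi k * Q) powi (- 2 * C_coeff (mu 1) (transposed (mu 2)) k))
        = (\<Prod>m\<in>S. (1 - q powi m * Q) powi (2 * e m))"
    unfolding C_coeff_eq[OF assms(1,2)] S_def e_def by simp
  have QN: "Q powi (- int (part_size (mu 1)) - int (part_size (mu 2))) = inverse (Q powi N)"
    by (simp add: N_def power_int_minus[symmetric])
  show ?thesis
    unfolding L P powr QN N_def[symmetric] four
    using nz by (simp add: power_int_minus power_int_mult_distrib field_simps)
qed

end
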